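(* Let $A\in\mathbb{R}^{n\times n}$ be a nonsingular $M$-matrix, let $m$ be an integer with $1\le m<n$, and let $0<\omega\le 1$. Then the generalized SOR (GSOR) method with parameters $m$ and $\omega$ for the system $Ax=b$ converges.
   Context: A real matrix $A\in\mathbb{R}^{n\times n}$ is an $M$-matrix if $A=sI-B$ with $B\ge 0$ entrywise and $s\ge\rho(B)$, where $\rho$ denotes the spectral radius. For an $n\times n$ matrix $A=(a_{ij})$ and an integer $1\le m<n$, write $A=T_m-E_m-F_m$, where $T_m$ has entries $a_{ij}$ if $|i-j|\le m$ and $0$ otherwise; $E_m$ has entries $-a_{ij}$ if $i>j+m$ and $0$ otherwise; $F_m$ has entries $-a_{ij}$ if $j>i+m$ and $0$ otherwise. The GSOR method with parameters $m$ and $\omega$ is the iteration $$x^{(k+1)}=(T_m-\omega E_m)^{-1}\left[(1-\omega)T_m+\omega F_m\right]x^{(k)}+\omega(T_m-\omega E_m)^{-1}b,\qquad k\ge 0.$$ "The method converges" means that $T_m-\omega E_m$ is invertible (so the iteration is defined) and that for every $b$ and every initial guess $x^{(0)}$ the sequence $x^{(k)}$ converges to the solution of $Ax=b$; equivalently, $T_m-\omega E_m$ is invertible and $\rho\big((T_m-\omega E_m)^{-1}[(1-\omega)T_m+\omega F_m]\big)<1$. *)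

theory Defs
  imports
    "Jordan_Normal_Form.Spectral_Radius"
    "Jordan_Normal_Form.Gauss_Jordan_Elimination"
begin

text \<open>The spectral radius of a real matrix is that of its complexification:
  non-real eigenvalues count. It is only meaningful for positive dimension.\<close>

definition real_spectral_radius :: "real mat \<Rightarrow> real" where
  "real_spectral_radius B = spectral_radius (map_mat complex_of_real B)"

definition M_matrix :: "nat \<Rightarrow> real mat \<Rightarrow> bool" where
  "M_matrix n A \<longleftrightarrow>
    (\<exists>s B. B \<in> carrier_mat n n \<and> (\<forall>i<n. \<forall>j<n. 0 \<le> B $$ (i, j)) \<and>
      real_spectral_radius B \<le> s \<and> A = s \<cdot>\<^sub>m 1\<^sub>m n - B)"

definition band_part :: "nat \<Rightarrow> real mat \<Rightarrow> real mat" where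
  "band_part m A = mat (dim_row A) (dim_col A)
    (\<lambda>(i, j). if \<bar>int i - int j\<bar> \<le> int m then A $$ (i, j) else 0)"

definition lower_part :: "nat \<Rightarrow> real mat \<Rightarrow> real mat" where
  "lower_part m A = mat (dim_row A) (dim_col A)
    (\<lambda>(i, j). if j + m < i then - A $$ (i, j) else 0)"

definition upper_part :: "nat \<Rightarrow> real mat \<Rightarrow> real mat" where
  "upper_part m A = mat (dim_row A) (dim_col A)
    (\<lambda>(i, j). if i + m < j then - A $$ (i, j) else 0)"

lemma band_splitting: "A = band_part m A - lower_part m A - upper_part m A"
  by (rule eq_matI) (auto simp: band_part_def lower_part_def upper_part_def)

definition gsor_lhs :: "nat \<Rightarrow> real \<Rightarrow> real mat \<Rightarrow> real mat" where
  "gsor_lhs m \<omega> A = band_part m A - \<omega> \<cdot>\<^sub>m lower_part m A"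

definition gsor_rhs :: "nat \<Rightarrow> real \<Rightarrow> real mat \<Rightarrow> real mat" where
  "gsor_rhs m \<omega> A = (1 - \<omega>) \<cdot>\<^sub>m band_part m A + \<omega> \<cdot>\<^sub>m upper_part m A"

text \<open>\<open>the (mat_inverse M)\<close> is the inverse of \<open>M\<close> only if \<open>M\<close> is invertible;
  \<open>gsor_converges\<close> below requires this of \<open>gsor_lhs m \<omega> A\<close>.\<close>

primrec gsor_iterate ::
  "nat \<Rightarrow> real \<Rightarrow> real mat \<Rightarrow> real vec \<Rightarrow> real vec \<Rightarrow> nat \<Rightarrow> real vec" where
  "gsor_iterate m \<omega> A b x0 0 = x0"
| "gsor_iterate m \<omega> A b x0 (Suc k) =
    (the (mat_inverse (gsor_lhs m \<omega> A)) * gsor_rhs m \<omega> A) *\<^sub>v gsor_iterate m \<omega> A b x0 k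
    + \<omega> \<cdot>\<^sub>v (the (mat_inverse (gsor_lhs m \<omega> A)) *\<^sub>v b)"

text \<open>Convergence of vectors is entrywise, as the type of vectors carries no topology.\<close>

definition vec_tendsto :: "nat \<Rightarrow> (nat \<Rightarrow> real vec) \<Rightarrow> real vec \<Rightarrow> bool" where
  "vec_tendsto n X x \<longleftrightarrow> (\<forall>i<n. (\<lambda>k. X k $ i) \<longlonglongrightarrow> x $ i)"

definition gsor_converges :: "nat \<Rightarrow> nat \<Rightarrow> real \<Rightarrow> real mat \<Rightarrow> bool" where
  "gsor_converges n m \<omega> A \<longleftrightarrow>
    invertible_mat (gsor_lhs m \<omega> A) \<and>
    (\<forall>b \<in> carrier_vec n. \<exists>!x. x \<in> carrier_vec n \<and> A *\<^sub>v x = b) \<and>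
    (\<forall>b \<in> carrier_vec n. \<forall>x \<in> carrier_vec n. A *\<^sub>v x = b \<longrightarrow>
      (\<forall>x0 \<in> carrier_vec n. vec_tendsto n (gsor_iterate m \<omega> A b x0) x))"

end

(* Since A = s I - B with B >= 0 and rho(B) <= s, the matrix t I - B is monotone for every t > s.
   Letting t tend to s and using that A is nonsingular, v := A^-1 (1,...,1)^T satisfies
   v > 0 and A v > 0.

   The splitting behind GSOR need not be regular, but with M = T_m - omega E_m and
   P = (1 - omega) E_m + F_m >= 0 one has A = M - P and
   (1 - omega) T_m + omega F_m = (1 - omega) M + omega P. So GSOR is the relaxation with
   parameter omega of the iteration x |-> M^-1 (P x + b), which contracts the maximum norm
   weighted by v because M is a Z-matrix and 0 <= P v < M v. *)

theory Submission
  imports Defs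
begin

section \<open>Matrix powers and their growth in terms of the spectral radius\<close>

lemma mult_mat_vec_index_sum:
  assumes "M \<in> carrier_mat n n" "x \<in> carrier_vec n" "i < n"
  shows "(M *\<^sub>v x) $ i = (\<Sum>j<n. M $$ (i, j) * x $ j)"
  using assms by (auto simp: scalar_prod_def atLeast0LessThan)

lemma pow_smult_mat:
  fixes A :: "'a :: comm_ring_1 mat"
  assumes "A \<in> carrier_mat n n"
  shows "(c \<cdot>\<^sub>m A) ^\<^sub>m k = c ^ k \<cdot>\<^sub>m A ^\<^sub>m k"
proof (induction k)
  case 0
  show ?case using assms by (auto intro!: eq_matI)
next
  case (Suc k)
  have "A ^\<^sub>m k \<in> carrier_mat n n" using assms by simp
  then have "(c ^ k \<cdot>\<^sub>m A ^\<^sub>m k) * (c \<cdot>\<^sub>m A) = c ^ Suc k \<cdot>\<^sub>m (A ^\<^sub>m k * A)"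
    using assms
    by (subst mult_smult_distrib[of _ n n _ n], simp, simp)
      (subst mult_smult_assoc_mat[of _ n n _ n], auto simp: ac_simps intro!: eq_matI)
  then show ?case using Suc by simp
qed

lemma map_mat_of_real_pow:
  assumes "B \<in> carrier_mat n n"
  shows "map_mat complex_of_real B ^\<^sub>m k = map_mat complex_of_real (B ^\<^sub>m k)"
proof (induction k)
  case 0
  show ?case using assms by (auto intro!: eq_matI)
next
  case (Suc k)
  have "B ^\<^sub>m k \<in> carrier_mat n n" using assms by simp
  then show ?case using Suc assms by (simp add: of_real_hom.mat_hom_mult[of _ n n _ n])
qed

lemma spectral_radius_nonneg:
  assumes "A \<in> carrier_mat n n" "0 < n"
  shows "0 \<le> spectral_radius A"
  using spectral_radius_mem_max(1)[OF assms] by auto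

text \<open>An eigenvalue \<open>k\<close> of the scaled matrix makes \<open>r * k\<close> an
  eigenvalue of \<open>A\<close>; taking \<open>k\<close> of maximal modulus gives
  \<open>r * norm k < r\<close>. This normalises to radius below 1, where powers stay
  bounded.\<close>

lemma spectral_radius_smult_less_1:
  assumes A: "A \<in> carrier_mat n n" and n: "0 < n"
    and r: "spectral_radius A < r"
  shows "spectral_radius (complex_of_real (1 / r) \<cdot>\<^sub>m A) < 1"
proof -
  let ?c = "complex_of_real (1 / r)"
  have r0: "0 < r" using spectral_radius_nonneg[OF A n] r by simp
  have cA: "?c \<cdot>\<^sub>m A \<in> carrier_mat n n" using A by simp
  obtain k where k: "eigenvalue (?c \<cdot>\<^sub>m A) k" and sr: "spectral_radius (?c \<cdot>\<^sub>m A) = norm k"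
    using spectral_radius_mem_max(1)[OF cA n] by (auto simp: spectrum_def)
  obtain v where v: "v \<in> carrier_vec n" "v \<noteq> 0\<^sub>v n" "(?c \<cdot>\<^sub>m A) *\<^sub>v v = k \<cdot>\<^sub>v v"
    using k A by (auto simp: eigenvalue_def eigenvector_def)
  have "A *\<^sub>v v = (of_real r * k) \<cdot>\<^sub>v v"
  proof (rule eq_vecI)
    fix i assume "i < dim_vec ((of_real r * k) \<cdot>\<^sub>v v)"
    then have i: "i < n" using v by simp
    have "((?c \<cdot>\<^sub>m A) *\<^sub>v v) $ i = ?c * (A *\<^sub>v v) $ i"
      using A v(1) i by (simp add: mult_mat_vec_index_sum[of _ n] sum_distrib_left ac_simps)
    moreover have "((?c \<cdot>\<^sub>m A) *\<^sub>v v) $ i = k * v $ i"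
      using v i by simp
    ultimately show "(A *\<^sub>v v) $ i = ((of_real r * k) \<cdot>\<^sub>v v) $ i"
      using r0 i v(1) by (simp add: field_simps)
  qed (use A v in auto)
  then have "of_real r * k \<in> spectrum A"
    using A v by (auto simp: spectrum_def eigenvalue_def eigenvector_def)
  then have "norm (of_real r * k) \<le> spectral_radius A"
    by (intro spectral_radius_mem_max(2)[OF A n]) blast
  then have "r * norm k \<le> spectral_radius A" using r0 by (simp add: norm_mult)
  then have "r * norm k < r * 1" using r by linarith
  then show ?thesis unfolding sr using r0 by (subst (asm) mult_less_cancel_left_pos)
qed

text \<open>The powers of \<open>B / r\<close> are bounded, by the Jordan normal form over the
  complex numbers, since the spectral radius of \<open>B / r\<close> is below 1. Multiplying back by
  \<open>r ^ k\<close> gives the growth rate for \<open>B\<close>.\<close>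

lemma pow_mat_entries_bound:
  assumes B: "B \<in> carrier_mat n n" and n: "0 < n" and r: "real_spectral_radius B < r"
  obtains c where "\<And>k i j. i < n \<Longrightarrow> j < n \<Longrightarrow> \<bar>(B ^\<^sub>m k) $$ (i, j)\<bar> \<le> c * r ^ k"
proof -
  let ?B = "map_mat complex_of_real B" and ?c = "complex_of_real (1 / r)"
  have B': "?B \<in> carrier_mat n n" using B by simp
  have r': "spectral_radius ?B < r" using r by (simp add: real_spectral_radius_def)
  have r0: "0 < r" using spectral_radius_nonneg[OF B' n] r' by simp
  obtain c where c: "\<And>k. norm_bound ((?c \<cdot>\<^sub>m ?B) ^\<^sub>m k) c"
    using spectral_radius_jnf_norm_bound_less_1_upper_triangular
      [OF _ spectral_radius_smult_less_1[OF B' n r'], of n] B' by auto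
  show thesis
  proof (rule that)
    fix k i j assume ij: "i < n" "j < n"
    have dim: "B ^\<^sub>m k \<in> carrier_mat n n" using B by simp
    have "norm (?c ^ k * complex_of_real ((B ^\<^sub>m k) $$ (i, j))) \<le> c"
      using c[of k] ij dim
      unfolding pow_smult_mat[OF B'] map_mat_of_real_pow[OF B] norm_bound_def
      by (simp add: carrier_matD[OF B] split: if_splits)
    then show "\<bar>(B ^\<^sub>m k) $$ (i, j)\<bar> \<le> c * r ^ k"
      using r0 by (simp add: norm_mult norm_power norm_divide field_simps)
  qed
qed

lemma pow_mat_nonneg:
  fixes B :: "real mat"
  assumes "B \<in> carrier_mat n n" "\<And>i j. i < n \<Longrightarrow> j < n \<Longrightarrow> 0 \<le> B $$ (i, j)"
    and "i < n" "j < n"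
  shows "0 \<le> (B ^\<^sub>m k) $$ (i, j)"
  using assms(3,4)
proof (induction k arbitrary: i j)
  case 0
  then show ?case using assms(1) by simp
next
  case (Suc k)
  have "B ^\<^sub>m k \<in> carrier_mat n n" using assms(1) by simp
  then show ?case using Suc assms(1,2)
    by (auto simp: scalar_prod_def intro!: sum_nonneg)
qed

section \<open>Monotonicity of t I - B above the spectral radius\<close>

text \<open>Iterating B x \<le> t x with B \<ge> 0 gives B^k x \<le> t^k x. The left side is of
  order r^k for some r < t, so dividing by t^k bounds x from below by a null sequence.\<close>

lemma nonneg_of_mult_le:
  assumes B: "B \<in> carrier_mat n n" and B0: "\<And>i j. i < n \<Longrightarrow> j < n \<Longrightarrow> 0 \<le> B $$ (i, j)"
    and t: "real_spectral_radius B < t"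
    and x: "x \<in> carrier_vec n" and Bx: "\<And>i. i < n \<Longrightarrow> (B *\<^sub>v x) $ i \<le> t * x $ i"
    and i: "i < n"
  shows "0 \<le> x $ i"
proof -
  have n: "0 < n" using i by simp
  have rho0: "0 \<le> real_spectral_radius B"
    unfolding real_spectral_radius_def by (rule spectral_radius_nonneg[OF _ n]) (use B in simp)
  obtain r where r: "real_spectral_radius B < r" "r < t" using dense[OF t] by blast
  have r0: "0 < r" and t0: "0 < t" using rho0 r by auto
  obtain c where c: "\<And>k i j. i < n \<Longrightarrow> j < n \<Longrightarrow> \<bar>(B ^\<^sub>m k) $$ (i, j)\<bar> \<le> c * r ^ k"
    using pow_mat_entries_bound[OF B n r(1)] by metis
  have iter: "(B ^\<^sub>m k *\<^sub>v x) $ i \<le> t ^ k * x $ i" for k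
  proof (induction k)
    case 0
    then show ?case using B x i by simp
  next
    case (Suc k)
    have Bk: "B ^\<^sub>m k \<in> carrier_mat n n" using B by simp
    have Bx': "B *\<^sub>v x \<in> carrier_vec n" using B x by simp
    \<comment> \<open>The new factor \<open>B\<close> is split off next to \<open>x\<close>, so the
      hypothesis on \<open>B\<close> and \<open>x\<close> can be used under the nonnegative matrix
      \<open>B ^\<^sub>m k\<close>, and the induction can stay at the fixed index
      \<open>i\<close>.\<close>
    have "(B ^\<^sub>m Suc k *\<^sub>v x) $ i = (B ^\<^sub>m k *\<^sub>v (B *\<^sub>v x)) $ i"
      using assoc_mult_mat_vec[OF Bk B x] by simp
    also have "\<dots> = (\<Sum>j<n. (B ^\<^sub>m k) $$ (i, j) * (B *\<^sub>v x) $ j)"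
      by (rule mult_mat_vec_index_sum[OF Bk Bx' i])
    also have "\<dots> \<le> (\<Sum>j<n. (B ^\<^sub>m k) $$ (i, j) * (t * x $ j))"
      by (intro sum_mono mult_left_mono Bx pow_mat_nonneg[OF B B0]) (use i in auto)
    also have "\<dots> = t * (B ^\<^sub>m k *\<^sub>v x) $ i"
      unfolding mult_mat_vec_index_sum[OF Bk x i] by (simp add: sum_distrib_left ac_simps)
    also have "\<dots> \<le> t * (t ^ k * x $ i)"
      using Suc t0 by (intro mult_left_mono) auto
    finally show ?case by simp
  qed
  define C where "C = c * (\<Sum>j<n. \<bar>x $ j\<bar>)"
  have low: "- C * (r / t) ^ k \<le> x $ i" for k
  proof -
    have Bk: "B ^\<^sub>m k \<in> carrier_mat n n" using B by simp
    have "\<bar>(B ^\<^sub>m k *\<^sub>v x) $ i\<bar> \<le> (\<Sum>j<n. \<bar>(B ^\<^sub>m k) $$ (i, j)\<bar> * \<bar>x $ j\<bar>)"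
      unfolding mult_mat_vec_index_sum[OF Bk x i] abs_mult[symmetric] by (rule sum_abs)
    also have "\<dots> \<le> (\<Sum>j<n. c * r ^ k * \<bar>x $ j\<bar>)"
      by (intro sum_mono mult_right_mono c) (use i in auto)
    also have "\<dots> = C * r ^ k" by (simp add: C_def sum_distrib_left sum_distrib_right ac_simps)
    finally have "- (C * r ^ k) \<le> t ^ k * x $ i" using iter[of k] by linarith
    then show ?thesis using t0 by (simp add: field_simps)
  qed
  have "(\<lambda>k. (r / t) ^ k) \<longlonglongrightarrow> 0" by (rule LIMSEQ_realpow_zero) (use r0 t0 r in auto)
  then have "(\<lambda>k. - C * (r / t) ^ k) \<longlonglongrightarrow> - C * 0" by (rule tendsto_mult_left)
  from tendsto_upperbound[OF this, of "x $ i"] low show ?thesis by auto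
qed

section \<open>Semipositivity of nonsingular M-matrices\<close>

lemma invertible_matE:
  assumes "invertible_mat A" "A \<in> carrier_mat n n"
  obtains W where "W \<in> carrier_mat n n" "A * W = 1\<^sub>m n" "W * A = 1\<^sub>m n"
proof -
  obtain W where W: "A * W = 1\<^sub>m n" "W * A = 1\<^sub>m (dim_row W)"
    using assms unfolding invertible_mat_def inverts_mat_def by auto
  have "dim_col W = n" using arg_cong[OF W(1), of dim_col] by simp
  moreover have "dim_row W = n" using arg_cong[OF W(2), of dim_col] assms(2) by simp
  ultimately show thesis using that[of W] W by auto
qed

lemma M_matrix_off_diag_nonpos:
  assumes "M_matrix n A" "i < n" "j < n" "i \<noteq> j"
  shows "A $$ (i, j) \<le> 0"
  using assms unfolding M_matrix_def by auto

text \<open>The vector is v = A^-1 u with u all ones. Only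
  \<open>real_spectral_radius B \<le> s\<close> is known, so monotonicity is applied to A + d I for
  small d > 0. The test vector v - d w with w = A^-1 v approximates (A + d I)^-1 u to first order in
  d.\<close>

lemma M_matrix_semipositive:
  assumes A: "A \<in> carrier_mat n n" and M: "M_matrix n A" and inv: "invertible_mat A"
  obtains v where "v \<in> carrier_vec n" "\<And>i. i < n \<Longrightarrow> 0 < v $ i" "\<And>i. i < n \<Longrightarrow> 0 < (A *\<^sub>v v) $ i"
proof -
  obtain s B where B: "B \<in> carrier_mat n n" and B0: "\<And>i j. i < n \<Longrightarrow> j < n \<Longrightarrow> 0 \<le> B $$ (i, j)"
    and s: "real_spectral_radius B \<le> s" and As: "A = s \<cdot>\<^sub>m 1\<^sub>m n - B"
    using M unfolding M_matrix_def by auto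
  obtain W where W: "W \<in> carrier_mat n n" "A * W = 1\<^sub>m n"
    using invertible_matE[OF inv A] by metis
  define u :: "real vec" where "u = vec n (\<lambda>_. 1)"
  define v where "v = W *\<^sub>v u"
  define w where "w = W *\<^sub>v v"
  have u: "u \<in> carrier_vec n" by (simp add: u_def)
  have v: "v \<in> carrier_vec n" and w: "w \<in> carrier_vec n" using W u by (auto simp: v_def w_def)
  have AW: "A *\<^sub>v (W *\<^sub>v x) = x" if "x \<in> carrier_vec n" for x
    using assoc_mult_mat_vec[OF A W(1) that] W(2) that by simp
  have Av: "A *\<^sub>v v = u" and Aw: "A *\<^sub>v w = v" using AW u v by (auto simp: v_def w_def)
  have Ax: "(A *\<^sub>v x) $ i = s * x $ i - (B *\<^sub>v x) $ i" if "x \<in> carrier_vec n" "i < n" for x i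
    using that B unfolding As
    by (subst minus_mult_distrib_mat_vec[of _ n n])
      (auto simp: mult_mat_vec_index_sum[of _ n] sum_distrib_left if_distrib[of "\<lambda>y. y * _"] sum.delta cong: if_cong)
  have Bv: "(B *\<^sub>v v) $ i = s * v $ i - 1" and Bw: "(B *\<^sub>v w) $ i = s * w $ i - v $ i"
    if "i < n" for i
    using Ax[OF v that] Ax[OF w that] that by (auto simp: Av Aw u_def)
  define C where "C = 1 + (\<Sum>j<n. \<bar>w $ j\<bar>)"
  have C1: "1 \<le> C" by (simp add: C_def sum_nonneg)
  have wC: "\<bar>w $ i\<bar> \<le> C" if "i < n" for i
    using member_le_sum[of i "{..<n}" "\<lambda>j. \<bar>w $ j\<bar>"] that by (simp add: C_def)
  have v0: "0 \<le> v $ i" if i: "i < n" for i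
  proof (rule field_le_epsilon)
    fix e :: real assume e: "0 < e"
    \<comment> \<open>Since \<open>C\<close> is at least 1 and bounds all entries of
      \<open>w\<close> in modulus, this \<open>d\<close> is at most 1 and satisfies both d^2 w_j
      \<le> 1, for the residual, and d w_i \<ge> - e, for the conclusion.\<close>
    define d where "d = min 1 e / C"
    have d: "0 < d" "d * C \<le> 1" "d * C \<le> e" using e C1 by (auto simp: d_def)
    have "d * 1 \<le> d * C" by (rule mult_left_mono) (use d C1 in auto)
    then have d1: "d \<le> 1" using d(2) by linarith
    have "0 \<le> (v - d \<cdot>\<^sub>v w) $ i"
    proof (rule nonneg_of_mult_le[OF B B0, of "s + d"])
      fix j assume j: "j < n"
      have "d * (d * w $ j) \<le> d * (d * C)" using wC[OF j] d by (intro mult_left_mono) auto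
      also have "\<dots> \<le> 1 * 1" using d d1 C1 by (intro mult_mono) auto
      finally have sq: "d * (d * w $ j) \<le> 1" by simp
      \<comment> \<open>The terms of first order cancel: (A + d I)(v - d w) = u - d v + d v - d^2 w
        = u - d^2 w, which is nonnegative by \<open>sq\<close>.\<close>
      have "(B *\<^sub>v (v - d \<cdot>\<^sub>v w)) $ j = (B *\<^sub>v v) $ j - d * (B *\<^sub>v w) $ j"
        using B v w j by (simp add: mult_mat_vec_index_sum[of _ n] sum_distrib_left algebra_simps sum_subtractf)
      then show "(B *\<^sub>v (v - d \<cdot>\<^sub>v w)) $ j \<le> (s + d) * (v - d \<cdot>\<^sub>v w) $ j"
        using Bv[OF j] Bw[OF j] sq v w j by (simp add: algebra_simps)
    qed (use s d v w i in auto)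
    then have "d * w $ i \<le> v $ i" using v w i by simp
    moreover have "d * (- C) \<le> d * w $ i" using wC[OF i] d by (intro mult_left_mono) auto
    ultimately show "0 \<le> v $ i + e" using d by simp
  qed
  show thesis
  proof (rule that[OF v])
    fix i assume i: "i < n"
    show "0 < (A *\<^sub>v v) $ i" using i by (simp add: Av u_def)
    \<comment> \<open>Strictness: s v_i = 1 + (B v)_i \<ge> 1 excludes v_i = 0.\<close>
    have "0 \<le> (B *\<^sub>v v) $ i"
      unfolding mult_mat_vec_index_sum[OF B v i] using B0 v0 i by (auto intro!: sum_nonneg)
    then have "s * v $ i \<noteq> 0" using Bv[OF i] by linarith
    then show "0 < v $ i" using v0[OF i] by (auto simp: less_le)
  qed
qed

section \<open>Z-matrices that map a positive vector to a positive vector\<close>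

text \<open>Let c be the minimum of x_j / v_j, attained at i. Then x - c v is nonnegative and
  vanishes at i, so row i sees only off-diagonal entries and (M x)_i \<le> c (M v)_i. Hence c \<ge>
  0, and x \<ge> c v \<ge> 0.\<close>

lemma Z_matrix_monotone:
  fixes M :: "real mat"
  assumes M: "M \<in> carrier_mat n n"
    and off: "\<And>i j. i < n \<Longrightarrow> j < n \<Longrightarrow> i \<noteq> j \<Longrightarrow> M $$ (i, j) \<le> 0"
    and v: "v \<in> carrier_vec n" and v0: "\<And>i. i < n \<Longrightarrow> 0 < v $ i"
    and Mv: "\<And>i. i < n \<Longrightarrow> 0 < (M *\<^sub>v v) $ i"
    and x: "x \<in> carrier_vec n" and Mx: "\<And>i. i < n \<Longrightarrow> 0 \<le> (M *\<^sub>v x) $ i"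
    and k: "k < n"
  shows "0 \<le> x $ k"
proof -
  obtain i where i: "i < n" and min: "\<And>j. j < n \<Longrightarrow> x $ i / v $ i \<le> x $ j / v $ j"
    using ex_is_arg_min_if_finite[of "{..<n}" "\<lambda>j. x $ j / v $ j"] k
    by (fastforce simp: is_arg_min_linorder)
  define c where "c = x $ i / v $ i"
  have ci: "x $ i = c * v $ i" using v0[OF i] by (simp add: c_def)
  have cj: "c * v $ j \<le> x $ j" if "j < n" for j
    using min[OF that] v0[OF that] by (simp add: c_def field_simps)
  have "(M *\<^sub>v x) $ i - c * (M *\<^sub>v v) $ i = (\<Sum>j<n. M $$ (i, j) * (x $ j - c * v $ j))"
    unfolding mult_mat_vec_index_sum[OF M x i] mult_mat_vec_index_sum[OF M v i]
    by (simp add: sum_distrib_left algebra_simps sum_subtractf)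
  also have "\<dots> \<le> 0"
  proof (rule sum_nonpos)
    fix j assume "j \<in> {..<n}"
    then show "M $$ (i, j) * (x $ j - c * v $ j) \<le> 0"
      using off[OF i, of j] cj[of j] ci by (cases "i = j") (auto simp: mult_le_0_iff)
  qed
  finally have "0 \<le> c * (M *\<^sub>v v) $ i" using Mx[OF i] by linarith
  then have "0 \<le> c" using Mv[OF i] by (simp add: zero_le_mult_iff)
  then show ?thesis using cj[OF k] v0[OF k] by (smt (verit) mult_nonneg_nonneg)
qed

text \<open>Monotonicity applied to both x and -x shows that the kernel is trivial. The conclusion
  has the form that the specification of \<open>mat_inverse\<close> expects.\<close>

lemma Z_matrix_invertible:
  fixes M :: "real mat"
  assumes M: "M \<in> carrier_mat n n"
    and off: "\<And>i j. i < n \<Longrightarrow> j < n \<Longrightarrow> i \<noteq> j \<Longrightarrow> M $$ (i, j) \<le> 0"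
    and v: "v \<in> carrier_vec n" and v0: "\<And>i. i < n \<Longrightarrow> 0 < v $ i"
    and Mv: "\<And>i. i < n \<Longrightarrow> 0 < (M *\<^sub>v v) $ i"
  shows "M \<in> Units (ring_mat TYPE(real) n ())"
proof -
  have "x = 0\<^sub>v n" if x: "x \<in> carrier_vec n" and Mx: "M *\<^sub>v x = 0\<^sub>v n" for x
  proof (rule eq_vecI)
    fix i assume "i < dim_vec (0\<^sub>v n :: real vec)"
    then have i: "i < n" by simp
    have "M *\<^sub>v (- x) = - (M *\<^sub>v x)"
      using M x by (auto intro!: eq_vecI)
    then have "0 \<le> x $ i" "0 \<le> (- x) $ i"
      using Z_matrix_monotone[OF M off v v0 Mv, of x i] Z_matrix_monotone[OF M off v v0 Mv, of "- x" i]
        x i Mx by auto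
    then show "x $ i = 0\<^sub>v n $ i" using x i by simp
  qed (use x in simp)
  then have "det M \<noteq> 0" using det_0_iff_vec_prod_zero[OF M] by blast
  then show ?thesis by (rule det_non_zero_imp_unit[OF M])
qed

text \<open>On units \<open>mat_inverse\<close> is not \<open>None\<close>, so the
  \<open>the\<close> in \<open>gsor_iterate\<close> denotes a genuine two-sided inverse.\<close>

lemma mat_inverse_of_unit:
  fixes M :: "'a :: field mat"
  assumes M: "M \<in> carrier_mat n n" and U: "M \<in> Units (ring_mat TYPE('a) n ())"
  shows "the (mat_inverse M) \<in> carrier_mat n n"
    and "M * the (mat_inverse M) = 1\<^sub>m n" and "the (mat_inverse M) * M = 1\<^sub>m n"
proof -
  obtain B where B: "mat_inverse M = Some B"
    using mat_inverse(1)[OF M, of "()"] U by (cases "mat_inverse M") simp_all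
  show "the (mat_inverse M) \<in> carrier_mat n n"
    and "M * the (mat_inverse M) = 1\<^sub>m n" and "the (mat_inverse M) * M = 1\<^sub>m n"
    using mat_inverse(2)[OF M B] B by simp_all
qed

section \<open>Contraction of the relaxed iteration in a weighted maximum norm\<close>

text \<open>In the norm weighted by \<open>v\<close>, the matrix \<open>M\<^sup>-\<^sup>1 P\<close> has a norm \<open>\<kappa> < 1\<close>, so the
  relaxed iteration matrix \<open>(1 - \<omega>) I + \<omega> M\<^sup>-\<^sup>1 P\<close> has norm at most \<open>1 - \<omega> (1 - \<kappa>)\<close>.\<close>

lemma relaxed_splitting_tendsto_0:
  fixes M P :: "real mat"
  assumes M: "M \<in> carrier_mat n n"
    and off: "\<And>i j. i < n \<Longrightarrow> j < n \<Longrightarrow> i \<noteq> j \<Longrightarrow> M $$ (i, j) \<le> 0"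
    and P: "P \<in> carrier_mat n n" and P0: "\<And>i j. i < n \<Longrightarrow> j < n \<Longrightarrow> 0 \<le> P $$ (i, j)"
    and v: "v \<in> carrier_vec n" and v0: "\<And>i. i < n \<Longrightarrow> 0 < v $ i"
    and Pv: "\<And>i. i < n \<Longrightarrow> (P *\<^sub>v v) $ i < (M *\<^sub>v v) $ i"
    and w: "0 < \<omega>" "\<omega> \<le> 1"
    and e: "\<And>k. e k \<in> carrier_vec n"
    and step: "\<And>k i. i < n \<Longrightarrow>
      (M *\<^sub>v e (Suc k)) $ i = (1 - \<omega>) * (M *\<^sub>v e k) $ i + \<omega> * (P *\<^sub>v e k) $ i"
    and i: "i < n"
  shows "(\<lambda>k. e k $ i) \<longlonglongrightarrow> 0"
proof -
  have Pv0: "0 \<le> (P *\<^sub>v v) $ j" if "j < n" for j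
    unfolding mult_mat_vec_index_sum[OF P v that]
    by (intro sum_nonneg mult_nonneg_nonneg P0 less_imp_le[OF v0]) (use that in auto)
  have Mv: "0 < (M *\<^sub>v v) $ j" if "j < n" for j
    using Pv[OF that] Pv0[OF that] by linarith
  \<comment> \<open>The maximum of these ratios is the least constant with P v \<le> \<kappa> M v.
    It is below 1 because each of the finitely many ratios is; the index \<open>i\<close> makes the
    set nonempty.\<close>
  define K where "K = (\<lambda>j. (P *\<^sub>v v) $ j / (M *\<^sub>v v) $ j) ` {..<n}"
  define \<kappa> where "\<kappa> = Max K"
  have K: "finite K" "K \<noteq> {}" using i by (auto simp: K_def)
  have \<kappa>: "0 \<le> \<kappa>" "\<kappa> < 1"
  proof -
    have "\<kappa> \<in> K" unfolding \<kappa>_def by (rule Max_in[OF K])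
    then obtain j where "j < n" "\<kappa> = (P *\<^sub>v v) $ j / (M *\<^sub>v v) $ j"
      unfolding K_def by (elim imageE) simp
    then show "0 \<le> \<kappa>" "\<kappa> < 1"
      using Pv0[of j] Mv[of j] Pv[of j] by (auto simp: less_imp_le)
  qed
  have PMv: "(P *\<^sub>v v) $ j \<le> \<kappa> * (M *\<^sub>v v) $ j" if "j < n" for j
  proof -
    have "(P *\<^sub>v v) $ j / (M *\<^sub>v v) $ j \<le> \<kappa>"
      unfolding \<kappa>_def by (rule Max_ge[OF K(1)]) (use that in \<open>simp add: K_def\<close>)
    then show ?thesis using Mv[OF that] by (simp add: field_simps)
  qed
  \<comment> \<open>A convex combination of 1 and \<kappa>, with positive weight \<omega> on
    \<kappa>.\<close>
  define \<theta> where "\<theta> = 1 - \<omega> + \<omega> * \<kappa>"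
  have \<theta>: "0 \<le> \<theta>" "\<theta> < 1" using w \<kappa> by (auto simp: \<theta>_def)
  have contract: "\<bar>e (Suc k) $ j\<bar> \<le> \<theta> * c * v $ j"
    if c: "0 \<le> c" and bd: "\<And>j. j < n \<Longrightarrow> \<bar>e k $ j\<bar> \<le> c * v $ j" and j: "j < n" for k c j
  proof -
    \<comment> \<open>Removing the part (1 - \<omega>) e_k carried over by relaxation leaves M z =
      \<omega> P e_k, which can be compared with M v.\<close>
    define z where "z = e (Suc k) - (1 - \<omega>) \<cdot>\<^sub>v e k"
    have z: "z \<in> carrier_vec n" using e by (simp add: z_def)
    have Mz: "(M *\<^sub>v z) $ l = \<omega> * (P *\<^sub>v e k) $ l" if "l < n" for l
    proof -
      have "(M *\<^sub>v z) $ l = (M *\<^sub>v e (Suc k)) $ l - (1 - \<omega>) * (M *\<^sub>v e k) $ l"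
        unfolding mult_mat_vec_index_sum[OF M z that] mult_mat_vec_index_sum[OF M e that]
        using e[of k, THEN carrier_vecD] e[of "Suc k", THEN carrier_vecD]
        by (simp add: z_def sum_distrib_left algebra_simps sum_subtractf sum.distrib)
      then show ?thesis using step[OF that] by simp
    qed
    have Pe: "\<bar>(P *\<^sub>v e k) $ l\<bar> \<le> c * \<kappa> * (M *\<^sub>v v) $ l" if l: "l < n" for l
    proof -
      have "\<bar>(P *\<^sub>v e k) $ l\<bar> \<le> (\<Sum>j<n. \<bar>P $$ (l, j) * e k $ j\<bar>)"
        unfolding mult_mat_vec_index_sum[OF P e l] by (rule sum_abs)
      also have "\<dots> \<le> (\<Sum>j<n. P $$ (l, j) * (c * v $ j))"
        using P0[OF l] bd by (intro sum_mono) (auto simp: abs_mult intro!: mult_left_mono)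
      also have "\<dots> = c * (P *\<^sub>v v) $ l"
        unfolding mult_mat_vec_index_sum[OF P v l] by (simp add: sum_distrib_left ac_simps)
      also have "\<dots> \<le> c * (\<kappa> * (M *\<^sub>v v) $ l)"
        using PMv[OF l] c by (rule mult_left_mono)
      finally show ?thesis by simp
    qed
    define a where "a = \<omega> * (c * \<kappa>)"
    have bound: "\<bar>\<omega> * (P *\<^sub>v e k) $ l\<bar> \<le> a * (M *\<^sub>v v) $ l" if "l < n" for l
      using mult_left_mono[OF Pe[OF that], of \<omega>] w by (simp add: a_def abs_mult ac_simps)
    \<comment> \<open>The signs d = 1 and d = -1 together give |z| \<le> a v: both M (a v + z) and M
      (a v - z) are nonnegative, and \<open>M\<close> is monotone.\<close>
    have "0 \<le> (a \<cdot>\<^sub>v v + d \<cdot>\<^sub>v z) $ j" if d: "\<bar>d\<bar> = 1" for d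
    proof (rule Z_matrix_monotone[OF M off v v0 Mv])
      fix l assume l: "l < n"
      have "(M *\<^sub>v (a \<cdot>\<^sub>v v + d \<cdot>\<^sub>v z)) $ l = a * (M *\<^sub>v v) $ l + d * (M *\<^sub>v z) $ l"
        using M v z l
        by (simp add: mult_mat_vec_index_sum[of _ n] sum_distrib_left algebra_simps sum.distrib)
      moreover have "\<bar>d * (M *\<^sub>v z) $ l\<bar> \<le> a * (M *\<^sub>v v) $ l"
        using bound[OF l] d by (simp add: abs_mult Mz[OF l])
      ultimately show "0 \<le> (M *\<^sub>v (a \<cdot>\<^sub>v v + d \<cdot>\<^sub>v z)) $ l" by linarith
    qed (use v z j in auto)
    from this[of 1] this[of "-1"] have "\<bar>z $ j\<bar> \<le> a * v $ j" using v z j by simp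
    moreover have "e (Suc k) $ j = z $ j + (1 - \<omega>) * e k $ j"
      using e[of k, THEN carrier_vecD] e[of "Suc k", THEN carrier_vecD] j by (simp add: z_def)
    moreover have "\<bar>(1 - \<omega>) * e k $ j\<bar> \<le> (1 - \<omega>) * (c * v $ j)"
      using bd[OF j] w by (simp add: abs_mult mult_left_mono)
    ultimately have "\<bar>e (Suc k) $ j\<bar> \<le> a * v $ j + (1 - \<omega>) * (c * v $ j)" by linarith
    then show ?thesis by (simp add: \<theta>_def a_def algebra_simps)
  qed
  \<comment> \<open>The sum dominates the weighted maximum norm of the initial error.\<close>
  define c where "c = (\<Sum>j<n. \<bar>e 0 $ j\<bar> / v $ j)"
  have c0: "0 \<le> c" unfolding c_def using v0 by (auto intro!: sum_nonneg simp: less_imp_le)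
  have bd: "j < n \<Longrightarrow> \<bar>e k $ j\<bar> \<le> (\<theta> ^ k * c) * v $ j" for k j
  proof (induction k arbitrary: j)
    case 0
    have "\<bar>e 0 $ j\<bar> / v $ j \<le> c"
      unfolding c_def by (rule member_le_sum) (use 0 v0 in \<open>auto simp: less_imp_le\<close>)
    then show ?case using v0[OF 0] by (simp add: field_simps)
  next
    case (Suc k)
    then show ?case using contract[of "\<theta> ^ k * c" k j] \<theta> c0 by (simp add: ac_simps)
  qed
  have "(\<lambda>k. \<theta> ^ k) \<longlonglongrightarrow> 0" using \<theta> by (rule LIMSEQ_realpow_zero)
  \<comment> \<open>The instantiated \<open>K\<close> is the constant factor in
    \<open>tendsto_0_le\<close>, unrelated to the set of ratios above.\<close>
  then show ?thesis
    by (rule tendsto_0_le[where K = "c * v $ i"]) (use bd[OF i] \<theta> in \<open>simp add: ac_simps\<close>)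
qed

section \<open>Convergence of GSOR\<close>

theorem theorem3p13:
  fixes A :: "real mat" and n m :: nat and \<omega> :: real
  assumes "A \<in> carrier_mat n n"
    and "M_matrix n A"
    and "invertible_mat A"
    and "1 \<le> m" and "m < n"
    and "0 < \<omega>" and "\<omega> \<le> 1"
  shows "gsor_converges n m \<omega> A"
proof -
  note A = assms(1)
  note w = assms(6,7)
  define M where "M = gsor_lhs m \<omega> A"
  define N where "N = gsor_rhs m \<omega> A"
  define P where "P = (1 - \<omega>) \<cdot>\<^sub>m lower_part m A + upper_part m A"
  note defs = M_def N_def P_def gsor_lhs_def gsor_rhs_def band_part_def lower_part_def upper_part_def
  have M: "M \<in> carrier_mat n n" and N: "N \<in> carrier_mat n n" and P: "P \<in> carrier_mat n n"
    using A by (auto simp: defs)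
  have offA: "\<And>i j. i < n \<Longrightarrow> j < n \<Longrightarrow> i \<noteq> j \<Longrightarrow> A $$ (i, j) \<le> 0"
    using M_matrix_off_diag_nonpos[OF assms(2)] by blast
  \<comment> \<open>The entry of \<open>M\<close> is a_ij inside the band, \<omega> a_ij below it
    and 0 above it.\<close>
  have off: "M $$ (i, j) \<le> 0" if "i < n" "j < n" "i \<noteq> j" for i j
    using offA[OF that] that A w by (auto simp: defs mult_le_0_iff)
  \<comment> \<open>\<open>P\<close> is supported strictly outside the band, hence off the diagonal,
    where the sign of a_ij is known; 1 - \<omega> \<ge> 0 handles the lower part.\<close>
  have P0: "0 \<le> P $$ (i, j)" if "i < n" "j < n" for i j
    using offA[of i j] that A w by (auto simp: defs mult_le_0_iff)
  have MPA: "A $$ (i, j) = M $$ (i, j) - P $$ (i, j)"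
    and NMP: "N $$ (i, j) = (1 - \<omega>) * M $$ (i, j) + \<omega> * P $$ (i, j)"
    if "i < n" "j < n" for i j
    using that A by (auto simp: defs algebra_simps)
  have Ax: "(A *\<^sub>v x) $ i = (M *\<^sub>v x) $ i - (P *\<^sub>v x) $ i"
    and Nx: "(N *\<^sub>v x) $ i = (1 - \<omega>) * (M *\<^sub>v x) $ i + \<omega> * (P *\<^sub>v x) $ i"
    if "x \<in> carrier_vec n" "i < n" for x i
    using that A M N P
    by (simp_all add: mult_mat_vec_index_sum[of _ n] MPA NMP sum_distrib_left algebra_simps
        sum_subtractf sum.distrib del: index_mult_mat_vec)
  obtain v where v: "v \<in> carrier_vec n" and v0: "\<And>i. i < n \<Longrightarrow> 0 < v $ i"
    and Av: "\<And>i. i < n \<Longrightarrow> 0 < (A *\<^sub>v v) $ i"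
    using M_matrix_semipositive[OF A assms(2,3)] by metis
  have Pv: "(P *\<^sub>v v) $ i < (M *\<^sub>v v) $ i" if "i < n" for i
    using Av[OF that] Ax[OF v that] by simp
  have Mv: "0 < (M *\<^sub>v v) $ i" if i: "i < n" for i
  proof -
    have "0 \<le> (P *\<^sub>v v) $ i"
      unfolding mult_mat_vec_index_sum[OF P v i]
      by (intro sum_nonneg mult_nonneg_nonneg P0 less_imp_le[OF v0]) (use i in auto)
    then show ?thesis using Pv[OF i] by linarith
  qed
  define I where "I = the (mat_inverse M)"
  have I: "I \<in> carrier_mat n n" "M * I = 1\<^sub>m n" "I * M = 1\<^sub>m n"
    using mat_inverse_of_unit[OF M Z_matrix_invertible[OF M off v v0 Mv]] by (auto simp: I_def)
  have inv: "invertible_mat M"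
    unfolding invertible_mat_def inverts_mat_def using M I by auto
  obtain W where W: "W \<in> carrier_mat n n" "A * W = 1\<^sub>m n" "W * A = 1\<^sub>m n"
    using invertible_matE[OF assms(3) A] by metis
  have uniq: "\<exists>!x. x \<in> carrier_vec n \<and> A *\<^sub>v x = b" if b: "b \<in> carrier_vec n" for b
  proof (rule ex1I[of _ "W *\<^sub>v b"])
    show "W *\<^sub>v b \<in> carrier_vec n \<and> A *\<^sub>v (W *\<^sub>v b) = b"
      using assoc_mult_mat_vec[OF A W(1) b] W b by simp
    fix x assume "x \<in> carrier_vec n \<and> A *\<^sub>v x = b"
    then show "x = W *\<^sub>v b"
      using assoc_mult_mat_vec[OF W(1) A, of x] W by auto
  qed
  have conv: "vec_tendsto n (gsor_iterate m \<omega> A b x0) x"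
    if b: "b \<in> carrier_vec n" and x: "x \<in> carrier_vec n" and sol: "A *\<^sub>v x = b"
      and x0: "x0 \<in> carrier_vec n" for b x x0
    unfolding vec_tendsto_def
  proof (intro allI impI)
    fix i assume i: "i < n"
    define X where "X = gsor_iterate m \<omega> A b x0"
    have X_Suc: "X (Suc k) = (I * N) *\<^sub>v X k + \<omega> \<cdot>\<^sub>v (I *\<^sub>v b)" for k
      by (simp add: X_def I_def M_def N_def)
    have X: "X k \<in> carrier_vec n" for k
    proof (cases k)
      case 0
      then show ?thesis using x0 by (simp add: X_def)
    next
      case (Suc l)
      then show ?thesis using I by (intro carrier_vecI) (simp add: X_Suc)
    qed
    \<comment> \<open>Multiplying by \<open>M\<close> puts the iteration in implicit form, without
      the inverse.\<close>
    have MX: "M *\<^sub>v X (Suc k) = N *\<^sub>v X k + \<omega> \<cdot>\<^sub>v b" for k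
    proof -
      have NX: "N *\<^sub>v X k \<in> carrier_vec n" using N X by simp
      have "X (Suc k) = I *\<^sub>v (N *\<^sub>v X k + \<omega> \<cdot>\<^sub>v b)"
        unfolding X_Suc assoc_mult_mat_vec[OF I(1) N X]
        using mult_add_distrib_mat_vec[OF I(1) NX, of "\<omega> \<cdot>\<^sub>v b"] mult_mat_vec[OF I(1) b] b by simp
      then show ?thesis
        using assoc_mult_mat_vec[OF M I(1), of "N *\<^sub>v X k + \<omega> \<cdot>\<^sub>v b"] NX b I by simp
    qed
    define e where "e k = X k - x" for k
    have "(\<lambda>k. e k $ i) \<longlonglongrightarrow> 0"
    proof (rule relaxed_splitting_tendsto_0[OF M off P P0 v v0 Pv w _ _ i])
      show e: "e k \<in> carrier_vec n" for k using X x by (simp add: e_def)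
      fix k j assume j: "j < n"
      have "(M *\<^sub>v e (Suc k)) $ j = (M *\<^sub>v X (Suc k)) $ j - (M *\<^sub>v x) $ j"
        unfolding e_def using mult_minus_distrib_mat_vec[OF M X x] M x j by simp
      \<comment> \<open>Here b is replaced by A x = M x - P x. Then N x = (1 - \<omega>) M x +
        \<omega> P x turns the remainder into - N x, so the error obeys M e_(k+1) = N e_k.\<close>
      also have "\<dots> = (N *\<^sub>v X k) $ j + \<omega> * ((M *\<^sub>v x) $ j - (P *\<^sub>v x) $ j) - (M *\<^sub>v x) $ j"
        using MX[of k] N b j Ax[OF x j] sol by simp
      also have "\<dots> = (N *\<^sub>v X k) $ j - (N *\<^sub>v x) $ j"
        using Nx[OF x j] by (simp add: algebra_simps)
      also have "\<dots> = (N *\<^sub>v e k) $ j"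
        unfolding e_def using mult_minus_distrib_mat_vec[OF N X x] N x j by simp
      finally show "(M *\<^sub>v e (Suc k)) $ j = (1 - \<omega>) * (M *\<^sub>v e k) $ j + \<omega> * (P *\<^sub>v e k) $ j"
        using Nx[OF e j] by simp
    qed
    then have "(\<lambda>k. X k $ i - x $ i) \<longlonglongrightarrow> 0" using x i by (simp add: e_def)
    then show "(\<lambda>k. gsor_iterate m \<omega> A b x0 k $ i) \<longlonglongrightarrow> x $ i"
      unfolding X_def by (rule LIM_zero_cancel)
  qed
  show ?thesis
    unfolding gsor_converges_def using inv uniq conv by (auto simp: M_def)
qed

end
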